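(* For every integer $n\ge 0$ and every integer $m$, the number of overpartitions $\vec{\pi}$ of $n$ with $\operatorname{crank1}(\vec{\pi})=m$ equals $\overline{M}(m,n)$, where the integers $\overline{M}(m,n)$ are defined by $$\sum_{n=0}^\infty\sum_{m}\overline{M}(m,n)z^mq^n=\frac{(q^2;q^2)_\infty}{(zq;q)_\infty(z^{-1}q;q)_\infty}.$$
   Context: Notation: $(a;q)_\infty=\prod_{k=0}^\infty(1-aq^k)$; the generating function is expanded as a formal power series in $q$ whose coefficients are Laurent polynomials in $z$. An overpartition of $n$ is a partition of $n$ in which the first occurrence of each part size may be overlined. It is identified with a pair $\vec{\pi}=(\pi_1,\pi_2)\in\mathcal{PD}\times\mathcal{P}$ with $|\vec\pi|=|\pi_1|+|\pi_2|=n$, where $\mathcal{P}$ is the set of all partitions, $\mathcal{PD}$ is the set of partitions into distinct parts (both sets include the empty partition $\varnothing$), $|\pi|$ is the sum of the parts of $\pi$, $\pi_1$ consists of the overlined parts and $\pi_2$ of the non-overlined parts. For a non-empty partition $\pi$, let $\ell(\pi)$ be its largest part, $\omega(\pi)$ the number of ones in $\pi$, and $\mu(\pi)$ the number of parts of $\pi$ larger than $\omega(\pi)$. The crank is $$\operatorname{crank}(\pi)=\begin{cases}\ell(\pi)&\text{if }\omega(\pi)=0,\\ \mu(\pi)-\omega(\pi)&\text{otherwise.}\end{cases}$$ For a partition $\pi$ into distinct parts define $\lambda(\pi)=0$ if $\pi=\varnothing$ or if $\ell(\pi)$ and $\ell(\pi)-1$ are both parts of $\pi$, and $\lambda(\pi)=1$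 otherwise (in particular $\lambda(\pi)=1$ if $\pi$ has exactly one part, including when $\pi$ is the partition consisting of the single part $1$). For an overpartition $\vec\pi=(\pi_1,\pi_2)\in\mathcal{PD}\times\mathcal{P}$ define $$\operatorname{crank1}(\vec{\pi})=\begin{cases}\operatorname{crank}(\pi_2)&\text{if }\pi_2\ne\varnothing,\\ \lambda(\pi_1)&\text{if }\pi_2=\varnothing.\end{cases}$$ *)

theory Defs
  imports "HOL-Analysis.Analysis" "HOL-Library.Multiset" "HOL-Library.Poly_Mapping"
begin

section \<open>Overpartitions and their first crank\<close>

text \<open>A partition is the multiset of its (positive) parts; \<open>sum_mset\<close> is its size.\<close>

definition partitions :: "nat multiset set"  (\<open>\<P>\<close>)
  where "\<P> = {\<pi>. 0 \<notin># \<pi>}"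

definition distinct_partitions :: "nat multiset set"  (\<open>\<P>\<D>\<close>)
  where "\<P>\<D> = {\<pi> \<in> \<P>. \<forall>k. count \<pi> k \<le> 1}"

text \<open>First component: overlined parts; second component: non-overlined parts.\<close>

definition overpartitions :: "nat \<Rightarrow> (nat multiset \<times> nat multiset) set"
  where "overpartitions n =
    {(\<pi>1, \<pi>2). \<pi>1 \<in> \<P>\<D> \<and> \<pi>2 \<in> \<P> \<and> sum_mset \<pi>1 + sum_mset \<pi>2 = n}"

definition largest_part :: "nat multiset \<Rightarrow> nat"
  where "largest_part \<pi> = Max (set_mset \<pi>)"

definition num_ones :: "nat multiset \<Rightarrow> nat"
  where "num_ones \<pi> = count \<pi> 1"

definition num_parts_above_ones :: "nat multiset \<Rightarrow> nat"
  where "num_parts_above_ones \<pi> = size {#k \<in># \<pi>. k > num_ones \<pi>#}"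

text \<open>The next function is meaningful for non-empty partitions only.\<close>

definition crank :: "nat multiset \<Rightarrow> int"
  where "crank \<pi> =
    (if num_ones \<pi> = 0 then int (largest_part \<pi>)
     else int (num_parts_above_ones \<pi>) - int (num_ones \<pi>))"

text \<open>
  For the partition consisting of the single part 1 the truncated difference below is 0, which is
  not a part, so the value is 1.
\<close>

definition lambda_stat :: "nat multiset \<Rightarrow> int"
  where "lambda_stat \<pi> =
    (if \<pi> = {#} \<or> (largest_part \<pi> \<in># \<pi> \<and> largest_part \<pi> - 1 \<in># \<pi>) then 0 else 1)"

fun crank1 :: "nat multiset \<times> nat multiset \<Rightarrow> int"
  where "crank1 (\<pi>1, \<pi>2) = (if \<pi>2 \<noteq> {#} then crank \<pi>2 else lambda_stat \<pi>1)"

text \<open>The counting below is about finite sets.\<close>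

lemma finite_partitions_le: "finite {\<pi> \<in> \<P>. sum_mset \<pi> \<le> n}"
proof -
  have *: "size \<pi> \<le> sum_mset \<pi> \<and> set_mset \<pi> \<subseteq> {..sum_mset \<pi>}" if "0 \<notin># \<pi>" for \<pi> :: "nat multiset"
    using that
  proof (induction \<pi>)
    case (add k \<pi>)
    hence "1 \<le> k" "size \<pi> \<le> sum_mset \<pi>" "set_mset \<pi> \<subseteq> {..sum_mset \<pi>}"
      by (auto simp: Suc_le_eq)
    thus ?case by (auto simp: subset_iff trans_le_add2)
  qed simp
  have "{\<pi> \<in> \<P>. sum_mset \<pi> \<le> n} \<subseteq> (\<Union>s\<le>n. {\<pi>. set_mset \<pi> \<subseteq> {..n} \<and> size \<pi> = s})"
  proof
    fix \<pi> assume "\<pi> \<in> {\<pi> \<in> \<P>. sum_mset \<pi> \<le> n}"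
    hence "0 \<notin># \<pi>" "sum_mset \<pi> \<le> n" by (auto simp: partitions_def)
    with *[of \<pi>] have "size \<pi> \<le> n" "set_mset \<pi> \<subseteq> {..n}" by (auto simp: subset_iff)
    thus "\<pi> \<in> (\<Union>s\<le>n. {\<pi>. set_mset \<pi> \<subseteq> {..n} \<and> size \<pi> = s})" by blast
  qed
  moreover have "finite (\<Union>s\<le>n. {\<pi>. set_mset \<pi> \<subseteq> {..n} \<and> size \<pi> = s})"
    using finite_multisets_of_size[of "{..n}"] by (auto simp: multisets_of_size_def)
  ultimately show ?thesis by (rule finite_subset)
qed

lemma finite_overpartitions: "finite (overpartitions n)"
proof (rule finite_subset)
  show "overpartitions n \<subseteq> {\<pi> \<in> \<P>. sum_mset \<pi> \<le> n} \<times> {\<pi> \<in> \<P>. sum_mset \<pi> \<le> n}"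
    by (auto simp: overpartitions_def distinct_partitions_def)
qed (simp add: finite_partitions_le)


section \<open>The generating function\<close>

text \<open>
  Laurent polynomials in \<open>z\<close> over the integers are the finitely supported functions from integer
  exponents to integers, with convolution as multiplication. The generating function lives in the
  ring of formal power series in \<open>q\<close> over them, with its usual metric.
\<close>

type_synonym laurent_poly = "int \<Rightarrow>\<^sub>0 int"

definition zpow :: "int \<Rightarrow> laurent_poly"
  where "zpow m = Poly_Mapping.single m 1"

definition qpochhammer_inf :: "'a \<Rightarrow> 'a \<Rightarrow> 'a :: {t2_space, comm_ring_1}"
  where "qpochhammer_inf a q = prodinf (\<lambda>k. 1 - a * q ^ k)"

abbreviation Mbar_numerator :: "laurent_poly fps"
  where "Mbar_numerator \<equiv> qpochhammer_inf (fps_X ^ 2) (fps_X ^ 2)"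

abbreviation Mbar_denominator :: "laurent_poly fps"
  where "Mbar_denominator \<equiv>
    qpochhammer_inf (fps_const (zpow 1) * fps_X) fps_X *
    qpochhammer_inf (fps_const (zpow (-1)) * fps_X) fps_X"

text \<open>
  The coefficient ring is not a field, so \<open>inverse\<close> is not available on the power series ring.
  The denominator has constant coefficient 1, and \<open>fps_right_inverse D 1\<close> is its
  multiplicative inverse (lemma \<open>Mbar_gf_unique\<close> below).
\<close>

definition Mbar_gf :: "laurent_poly fps"
  where "Mbar_gf = Mbar_numerator * fps_right_inverse Mbar_denominator 1"

definition Mbar :: "int \<Rightarrow> nat \<Rightarrow> int"
  where "Mbar m n = Poly_Mapping.lookup (fps_nth Mbar_gf n) m"

text \<open>The infinite products converge, and the quotient is well defined.\<close>

lemma qpochhammer_inf_fps: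
  fixes a q :: "'a :: idom fps"
  assumes a: "fps_nth a 0 = 0" and q: "fps_nth q 0 = 0"
  shows "(\<lambda>k. 1 - a * q ^ k) has_prod qpochhammer_inf a q"
    and "fps_nth (qpochhammer_inf a q) 0 = 1"
proof -
  define P where "P = (\<lambda>n. \<Prod>k\<le>n. 1 - a * q ^ k)"
  define L where "L = Abs_fps (\<lambda>j. fps_nth (P j) j)"
  have low: "fps_nth (q ^ k) j = 0" if "j < k" for j k
    using q that by (simp add: fps_power_zeroth_eq_one startsby_zero_power_prefix)
  have step: "fps_nth (P (Suc n)) j = fps_nth (P n) j" if "j \<le> n" for n j
  proof -
    have "P (Suc n) = P n - (P n * a) * q ^ Suc n"
      by (simp add: P_def algebra_simps)
    moreover have "fps_nth ((P n * a) * q ^ Suc n) j = 0"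
      unfolding fps_mult_nth[of _ "q ^ Suc n"] using that by (intro sum.neutral ballI) (simp add: low del: power_Suc)
    ultimately show ?thesis by simp
  qed
  have stable: "fps_nth (P n) j = fps_nth L j" if "j \<le> n" for n j
    using that by (induction n rule: dec_induct) (simp_all add: step L_def)
  have lim: "P \<longlonglongrightarrow> L"
    unfolding tendsto_fps_iff
    by (auto intro!: eventually_sequentiallyI stable)
  have "fps_nth L 0 = 1"
    using a by (simp add: L_def P_def)
  hence "L \<noteq> 0" by auto
  with lim have L: "(\<lambda>k. 1 - a * q ^ k) has_prod L"
    by (simp add: has_prod_def raw_has_prod_def P_def)
  moreover from L have eq: "L = qpochhammer_inf a q"
    unfolding qpochhammer_inf_def by (rule has_prod_unique)
  ultimately show "(\<lambda>k. 1 - a * q ^ k) has_prod qpochhammer_inf a q"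
    by simp
  show "fps_nth (qpochhammer_inf a q) 0 = 1"
    using \<open>fps_nth L 0 = 1\<close> eq by simp
qed

lemma Mbar_gf_unique: "F * Mbar_denominator = Mbar_numerator \<longleftrightarrow> F = Mbar_gf"
proof -
  have quotient: "F * D = N \<longleftrightarrow> F = N * I" if DI: "D * I = 1" for D I N :: "laurent_poly fps"
  proof
    assume "F * D = N"
    hence "N * I = F * (D * I)" by (simp flip: mult.assoc)
    thus "F = N * I" by (simp only: DI mult_1_right)
  next
    assume "F = N * I"
    hence "F * D = N * (D * I)" by (simp only: mult.assoc mult.commute[of I D])
    thus "F * D = N" by (simp only: DI mult_1_right)
  qed
  have const: "fps_nth (f * g) 0 * 1 = 1" if "fps_nth f 0 = 1" "fps_nth g 0 = 1"
    for f g :: "laurent_poly fps"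
    using that by simp
  have "fps_nth Mbar_denominator 0 * 1 = 1"
    by (intro const qpochhammer_inf_fps) simp_all
  from quotient[OF fps_right_inverse[OF this]] show ?thesis
    by (simp only: Mbar_gf_def)
qed

end

theory Submission
  imports Defs
begin

text \<open>
  Write \<open>P(a)\<close> for \<open>(a; q)\<^sub>\<infinity>\<close> and \<open>C = P(q) / (P(z q) P(q / z))\<close>, the crank generating function.
  By the \<open>q\<close>-binomial theorem \<open>C\<close> equals
  \<open>(1 - q) / P(z q) * (\<Sum>k. (z q; q)\<^sub>k / (q; q)\<^sub>k * (q / z) ^ k)\<close>.
  The summand for \<open>k > 0\<close> counts the partitions with exactly \<open>k\<close> ones, a part above \<open>k\<close> having
  weight \<open>z\<close> and each one having weight \<open>1 / z\<close>. The summand \<open>(1 - q) / P(z q)\<close> is, by Euler's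
  identity, the generating function by largest part of the partitions without ones, up to terms
  of degree at most 1. Hence the non-empty partitions are counted by \<open>C - (1 - q + z q)\<close>.
  On the other hand, distinct partitions weighted by \<open>z\<close> to the power \<open>\<lambda>\<close> are counted by
  \<open>P(- q) (1 - q + z q)\<close>, because raising the largest part by one is a bijection onto the
  distinct partitions with \<open>\<lambda> = 1\<close>. So the overpartitions are counted by
  \<open>P(- q) (C - (1 - q + z q)) + P(- q) (1 - q + z q) = P(- q) C\<close>, and
  \<open>P(- q) P(q) = (q\<^sup>2; q\<^sup>2)\<^sub>\<infinity>\<close>.
\<close>

section \<open>Infinite products of power series and the \<open>q\<close>-binomial theorem\<close>

lemma fps_mult_nth_cong:
  assumes "\<And>i. i \<le> j \<Longrightarrow> fps_nth f i = fps_nth f' i"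
    and "\<And>i. i \<le> j \<Longrightarrow> fps_nth g i = fps_nth g' i"
  shows "fps_nth (f * g) j = fps_nth (f' * g') j"
  unfolding fps_mult_nth by (intro sum.cong) (auto simp: assms)

lemma fps_mult_nth_eq_0:
  fixes f g :: "'a::comm_ring_1 fps"
  assumes "\<And>i. i \<le> j \<Longrightarrow> fps_nth g i = 0"
  shows "fps_nth (f * g) j = 0"
  unfolding fps_mult_nth by (intro sum.neutral) (auto simp: assms)

lemma qpochhammer_inf_nth:
  fixes a q :: "'a::idom fps"
  assumes a: "fps_nth a 0 = 0" and q: "fps_nth q 0 = 0" and "j \<le> n"
  shows "fps_nth (qpochhammer_inf a q) j = fps_nth (\<Prod>k<n. 1 - a * q ^ k) j"
proof -
  let ?P = "\<lambda>n. \<Prod>k<n. 1 - a * q ^ k"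
  have low: "fps_nth (a * q ^ n) j = 0" if "j \<le> n" for j n
    unfolding fps_mult_nth
  proof (intro sum.neutral ballI)
    fix i assume "i \<in> {0..j}"
    show "fps_nth a i * fps_nth (q ^ n) (j - i) = 0"
    proof (cases "i = 0")
      case False
      thus ?thesis using that q \<open>i \<in> {0..j}\<close>
        by (simp add: fps_power_zeroth_eq_one startsby_zero_power_prefix)
    qed (simp add: a)
  qed
  have step: "fps_nth (?P (Suc n)) j = fps_nth (?P n) j" if "j \<le> n" for j n
  proof -
    have "?P (Suc n) = ?P n - ?P n * (a * q ^ n)"
      by (simp add: algebra_simps)
    moreover have "fps_nth (?P n * (a * q ^ n)) j = 0"
      using that by (intro fps_mult_nth_eq_0 low) auto
    ultimately show ?thesis by simp
  qed
  have stable: "fps_nth (?P m) j = fps_nth (?P n) j" if "n \<le> m" for m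
    using that \<open>j \<le> n\<close> by (induction m rule: dec_induct) (simp_all add: step del: prod.lessThan_Suc)
  have "eventually (\<lambda>m. fps_nth (?P m) j = fps_nth (qpochhammer_inf a q) j) sequentially"
    using has_prod_imp_tendsto'[OF qpochhammer_inf_fps(1)[OF a q]] by (auto simp: tendsto_fps_iff)
  then obtain M where M: "\<And>m. m \<ge> M \<Longrightarrow> fps_nth (?P m) j = fps_nth (qpochhammer_inf a q) j"
    by (auto simp: eventually_sequentially)
  show ?thesis using stable[of "max M n"] M[of "max M n"] by simp
qed

lemma qpochhammer_inf_split:
  fixes a q :: "'a::idom fps"
  assumes a: "fps_nth a 0 = 0" and q: "fps_nth q 0 = 0"
  shows "qpochhammer_inf a q = (\<Prod>k<n. 1 - a * q ^ k) * qpochhammer_inf (a * q ^ n) q"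
proof (rule fps_ext)
  fix j
  have aq: "fps_nth (a * q ^ n) 0 = 0" using a by simp
  have "fps_nth (qpochhammer_inf a q) j = fps_nth (\<Prod>k<n + j. 1 - a * q ^ k) j"
    by (rule qpochhammer_inf_nth[OF a q]) simp
  also have "(\<Prod>k<n + j. 1 - a * q ^ k) = (\<Prod>k<n. 1 - a * q ^ k) * (\<Prod>k<j. 1 - a * q ^ n * q ^ k)"
    by (induction j) (simp_all add: power_add algebra_simps)
  also have "fps_nth \<dots> j = fps_nth ((\<Prod>k<n. 1 - a * q ^ k) * qpochhammer_inf (a * q ^ n) q) j"
    by (rule fps_mult_nth_cong) (simp_all add: qpochhammer_inf_nth[OF aq q])
  finally show "fps_nth (qpochhammer_inf a q) j = fps_nth ((\<Prod>k<n. 1 - a * q ^ k) * qpochhammer_inf (a * q ^ n) q) j" .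
qed

lemma qpochhammer_inf_0:
  assumes "fps_nth (q :: 'a::idom fps) 0 = 0"
  shows "qpochhammer_inf 0 q = 1"
  by (rule fps_ext) (simp add: qpochhammer_inf_nth[OF _ assms order_refl])

text \<open>
  For an ascending family every coefficient of the sum is a finite sum: the members from index
  \<open>n + 1\<close> on do not contribute to the coefficient of \<open>q ^ n\<close>.
\<close>

definition ascending :: "(nat \<Rightarrow> 'a::comm_ring_1 fps) \<Rightarrow> bool"
  where "ascending f \<longleftrightarrow> (\<forall>k. \<forall>j<k. fps_nth (f k) j = 0)"

definition fps_suminf :: "(nat \<Rightarrow> 'a::comm_ring_1 fps) \<Rightarrow> 'a fps"
  where "fps_suminf f = Abs_fps (\<lambda>n. \<Sum>k\<le>n. fps_nth (f k) n)"

lemma fps_suminf_diff: "fps_suminf (\<lambda>k. f k - g k) = fps_suminf f - fps_suminf g"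
  by (rule fps_ext) (simp add: fps_suminf_def sum_subtractf)

lemma fps_suminf_mult:
  assumes "ascending f"
  shows "fps_suminf (\<lambda>k. g * f k) = g * fps_suminf f"
proof (rule fps_ext)
  fix n
  have "fps_nth (fps_suminf (\<lambda>k. g * f k)) n = (\<Sum>k\<le>n. \<Sum>i=0..n. fps_nth g i * fps_nth (f k) (n - i))"
    by (simp add: fps_suminf_def fps_mult_nth)
  also have "\<dots> = (\<Sum>i=0..n. \<Sum>k\<le>n. fps_nth g i * fps_nth (f k) (n - i))"
    by (rule sum.swap)
  also have "\<dots> = (\<Sum>i=0..n. fps_nth g i * (\<Sum>k\<le>n - i. fps_nth (f k) (n - i)))"
  proof (rule sum.cong[OF refl])
    fix i
    show "(\<Sum>k\<le>n. fps_nth g i * fps_nth (f k) (n - i)) = fps_nth g i * (\<Sum>k\<le>n - i. fps_nth (f k) (n - i))"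
      unfolding sum_distrib_left using assms
      by (intro sum.mono_neutral_right) (auto simp: ascending_def)
  qed
  also have "\<dots> = fps_nth (g * fps_suminf f) n"
    by (simp add: fps_suminf_def fps_mult_nth)
  finally show "fps_nth (fps_suminf (\<lambda>k. g * f k)) n = fps_nth (g * fps_suminf f) n" .
qed

lemma fps_suminf_Suc:
  assumes "ascending f"
  shows "fps_suminf f = f 0 + fps_suminf (\<lambda>k. f (Suc k))"
proof (rule fps_ext)
  fix n
  have "(\<Sum>k\<le>Suc n. fps_nth (f k) n) = (\<Sum>k\<le>n. fps_nth (f k) n)"
    using assms by (simp add: ascending_def)
  thus "fps_nth (fps_suminf f) n = fps_nth (f 0 + fps_suminf (\<lambda>k. f (Suc k))) n"
    by (simp add: fps_suminf_def sum.atMost_Suc_shift del: sum.atMost_Suc)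
qed

lemma ascending_mult_power:
  assumes "fps_nth t 0 = 0"
  shows "ascending (\<lambda>k. c k * t ^ k)"
  unfolding ascending_def using assms
  by (intro allI impI fps_mult_nth_eq_0) (simp add: fps_power_zeroth_eq_one startsby_zero_power_prefix)

text \<open>
  The sum \<open>F t\<close> satisfies \<open>(1 - t) * F t = (1 - a * t) * F (t * q)\<close>; iterating this \<open>n\<close> times
  determines it modulo \<open>q ^ (n + 1)\<close>.
\<close>

lemma q_binomial:
  fixes a t :: "'a::idom fps" and c :: "nat \<Rightarrow> 'a fps"
  assumes t: "fps_nth t 0 = 0" and c0: "c 0 = 1"
    and c: "\<And>k. (1 - fps_X ^ Suc k) * c (Suc k) = (1 - a * fps_X ^ k) * c k"
  shows "fps_suminf (\<lambda>k. c k * t ^ k) * qpochhammer_inf t fps_X = qpochhammer_inf (a * t) fps_X"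
proof (rule fps_ext)
  define F where "F = (\<lambda>t. fps_suminf (\<lambda>k. c k * t ^ k))"
  have functional: "(1 - t) * F t = (1 - a * t) * F (t * fps_X)" if t: "fps_nth t 0 = 0" for t
  proof -
    have asc: "ascending (\<lambda>k. c k * t ^ k)" "ascending (\<lambda>k. c k * (t * fps_X) ^ k)"
      using t by (auto intro!: ascending_mult_power)
    have asc': "ascending (\<lambda>k. (c k * (1 - fps_X ^ k)) * t ^ k)" "ascending (\<lambda>k. (c k * (1 - a * fps_X ^ k)) * t ^ k)"
      using t by (auto intro!: ascending_mult_power)
    have "F t - F (t * fps_X) = fps_suminf (\<lambda>k. (c k * (1 - fps_X ^ k)) * t ^ k)"
      unfolding F_def fps_suminf_diff[symmetric] by (simp add: algebra_simps power_mult_distrib)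
    also have "\<dots> = fps_suminf (\<lambda>k. (c (Suc k) * (1 - fps_X ^ Suc k)) * t ^ Suc k)"
      by (subst fps_suminf_Suc[OF asc'(1)]) simp
    also have "\<dots> = fps_suminf (\<lambda>k. t * ((c k * (1 - a * fps_X ^ k)) * t ^ k))"
      using c by (intro arg_cong[of _ _ fps_suminf] ext) (simp add: mult_ac)
    also have "\<dots> = t * fps_suminf (\<lambda>k. (c k * (1 - a * fps_X ^ k)) * t ^ k)"
      by (rule fps_suminf_mult[OF asc'(2)])
    also have "(\<lambda>k. (c k * (1 - a * fps_X ^ k)) * t ^ k) = (\<lambda>k. c k * t ^ k - a * (c k * (t * fps_X) ^ k))"
      by (simp add: algebra_simps power_mult_distrib)
    also have "fps_suminf \<dots> = F t - a * F (t * fps_X)"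
      unfolding fps_suminf_diff fps_suminf_mult[OF asc(2)] F_def ..
    finally show ?thesis by (simp add: algebra_simps)
  qed
  have iterate: "F t * (\<Prod>k<n. 1 - t * fps_X ^ k) = (\<Prod>k<n. 1 - a * t * fps_X ^ k) * F (t * fps_X ^ n)" for n
  proof (induction n)
    case (Suc n)
    have "F t * (\<Prod>k<Suc n. 1 - t * fps_X ^ k)
        = (\<Prod>k<n. 1 - a * t * fps_X ^ k) * ((1 - t * fps_X ^ n) * F (t * fps_X ^ n))"
      using Suc.IH by (simp add: mult_ac)
    also have "(1 - t * fps_X ^ n) * F (t * fps_X ^ n) = (1 - a * (t * fps_X ^ n)) * F (t * fps_X ^ n * fps_X)"
      using t by (intro functional) simp
    finally show ?case by (simp add: mult_ac)
  qed simp
  fix n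
  have small: "fps_nth (F (t * fps_X ^ n)) j = fps_nth 1 j" if "j \<le> n" for j
  proof -
    have "fps_nth (c k * (t * fps_X ^ n) ^ k) j = 0" if "k \<noteq> 0" for k
    proof -
      obtain l where k: "k = Suc l" using \<open>k \<noteq> 0\<close> by (cases k) auto
      have "fps_nth (c k * (t * fps_X ^ n) ^ l * (t * fps_X ^ n)) j = 0"
        using t \<open>j \<le> n\<close> by - (rule fps_mult_nth_eq_0, simp add: fps_X_power_mult_right_nth)
      thus ?thesis by (simp add: k mult_ac)
    qed
    hence "fps_nth (F (t * fps_X ^ n)) j = (\<Sum>k\<in>{0}. fps_nth (c k * (t * fps_X ^ n) ^ k) j)"
      unfolding F_def fps_suminf_def fps_nth_Abs_fps by (intro sum.mono_neutral_right) auto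
    thus ?thesis by (simp add: c0)
  qed
  have at: "fps_nth (a * t) 0 = 0" using t by simp
  have "fps_nth (F t * qpochhammer_inf t fps_X) n = fps_nth (F t * (\<Prod>k<n. 1 - t * fps_X ^ k)) n"
    using t by (intro fps_mult_nth_cong qpochhammer_inf_nth) auto
  also have "\<dots> = fps_nth ((\<Prod>k<n. 1 - a * t * fps_X ^ k) * F (t * fps_X ^ n)) n"
    by (simp only: iterate)
  also have "\<dots> = fps_nth (qpochhammer_inf (a * t) fps_X * 1) n"
    by (intro fps_mult_nth_cong small) (simp_all add: qpochhammer_inf_nth[OF at])
  finally show "fps_nth (fps_suminf (\<lambda>k. c k * t ^ k) * qpochhammer_inf t fps_X) n
      = fps_nth (qpochhammer_inf (a * t) fps_X) n"
    by (simp add: F_def)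
qed

section \<open>Weighted generating functions\<close>

definition gf :: "nat multiset set \<Rightarrow> (nat multiset \<Rightarrow> 'a::comm_ring_1) \<Rightarrow> 'a fps"
  where "gf S w = Abs_fps (\<lambda>n. \<Sum>\<pi> | \<pi> \<in> S \<and> sum_mset \<pi> = n. w \<pi>)"

lemma gf_cong: "S = T \<Longrightarrow> (\<And>\<pi>. \<pi> \<in> T \<Longrightarrow> v \<pi> = w \<pi>) \<Longrightarrow> gf S v = gf T w"
  by (auto simp: gf_def intro!: sum.cong)

lemma gf_empty [simp]: "gf {} w = 0"
  by (simp add: gf_def fps_eq_iff)

lemma member_le_sum_mset: "k \<in># \<pi> \<Longrightarrow> (k :: nat) \<le> sum_mset \<pi>"
  using sum_mset.remove[of k \<pi>] by simp

lemma finite_partitions_of: "S \<subseteq> \<P> \<Longrightarrow> finite {\<pi> \<in> S. sum_mset \<pi> = n}"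
  by (rule finite_subset[OF _ finite_partitions_le[of n]]) auto

lemma gf_Un:
  assumes "S \<subseteq> \<P>" "T \<subseteq> \<P>" "S \<inter> T = {}"
  shows "gf (S \<union> T) w = gf S w + gf T w"
proof (rule fps_ext)
  fix n
  have "{\<pi> \<in> S \<union> T. sum_mset \<pi> = n} = {\<pi> \<in> S. sum_mset \<pi> = n} \<union> {\<pi> \<in> T. sum_mset \<pi> = n}"
    by auto
  thus "fps_nth (gf (S \<union> T) w) n = fps_nth (gf S w + gf T w) n"
    using assms by (auto simp: gf_def intro!: sum.union_disjoint finite_partitions_of)
qed

lemma gf_bij:
  assumes "bij_betw \<phi> S T"
    and "\<And>\<pi>. \<pi> \<in> S \<Longrightarrow> sum_mset (\<phi> \<pi>) = d + sum_mset \<pi>"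
    and "\<And>\<pi>. \<pi> \<in> S \<Longrightarrow> w (\<phi> \<pi>) = c * v \<pi>"
  shows "gf T w = fps_const c * fps_X ^ d * gf S v"
proof (rule fps_ext)
  fix n
  have T: "T = \<phi> ` S" and inj: "inj_on \<phi> S" using assms(1) by (auto simp: bij_betw_def)
  have "{\<pi> \<in> T. sum_mset \<pi> = n} = \<phi> ` {\<pi> \<in> S. d + sum_mset \<pi> = n}"
    using assms(2) by (auto simp: T)
  also have "sum w \<dots> = (\<Sum>\<pi> | \<pi> \<in> S \<and> d + sum_mset \<pi> = n. w (\<phi> \<pi>))"
    using inj by (subst sum.reindex) (auto intro: inj_on_subset)
  also have "\<dots> = c * (\<Sum>\<pi> | \<pi> \<in> S \<and> d + sum_mset \<pi> = n. v \<pi>)"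
    by (simp add: sum_distrib_left assms(3))
  also have "\<dots> = fps_nth (fps_const c * fps_X ^ d * gf S v) n"
  proof (cases "n < d")
    case False
    hence "{\<pi> \<in> S. d + sum_mset \<pi> = n} = {\<pi> \<in> S. sum_mset \<pi> = n - d}" by auto
    thus ?thesis using False by (simp add: mult.assoc fps_X_power_mult_nth gf_def)
  qed (auto simp: mult.assoc fps_X_power_mult_nth)
  finally show "fps_nth (gf T w) n = fps_nth (fps_const c * fps_X ^ d * gf S v) n"
    by (simp add: gf_def)
qed

lemma gf_partition_by:
  assumes "S \<subseteq> \<P>" "\<And>\<pi>. \<pi> \<in> S \<Longrightarrow> g \<pi> \<le> sum_mset \<pi>"
  shows "gf S w = fps_suminf (\<lambda>k. gf {\<pi> \<in> S. g \<pi> = k} w)"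
    and "ascending (\<lambda>k. gf {\<pi> \<in> S. g \<pi> = k} w)"
proof -
  show "ascending (\<lambda>k. gf {\<pi> \<in> S. g \<pi> = k} w)"
    unfolding ascending_def gf_def using assms(2) by (fastforce intro!: sum.neutral)
  show "gf S w = fps_suminf (\<lambda>k. gf {\<pi> \<in> S. g \<pi> = k} w)"
  proof (rule fps_ext)
    fix n
    have "(\<Sum>k\<le>n. \<Sum>\<pi> | \<pi> \<in> {\<pi> \<in> S. sum_mset \<pi> = n} \<and> g \<pi> = k. w \<pi>) = (\<Sum>\<pi> | \<pi> \<in> S \<and> sum_mset \<pi> = n. w \<pi>)"
      using assms by (intro sum.group finite_partitions_of) auto
    thus "fps_nth (gf S w) n = fps_nth (fps_suminf (\<lambda>k. gf {\<pi> \<in> S. g \<pi> = k} w)) n"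
      by (simp add: gf_def fps_suminf_def conj_ac)
  qed
qed

definition parts_gf :: "nat set \<Rightarrow> (nat \<Rightarrow> 'a::comm_ring_1) \<Rightarrow> 'a fps"
  where "parts_gf A u = gf {\<pi>. set_mset \<pi> \<subseteq> A} (\<lambda>\<pi>. \<Prod>k\<in>#\<pi>. u k)"

lemma parts_gf_cong: "(\<And>k. k \<in> A \<Longrightarrow> u k = v k) \<Longrightarrow> parts_gf A u = parts_gf A v"
  unfolding parts_gf_def
  by (intro gf_cong refl arg_cong[of _ _ prod_mset] image_mset_cong) auto

lemma parts_gf_insert:
  assumes "0 \<notin> A" "k \<noteq> 0" "k \<notin> A"
  shows "parts_gf (insert k A) u * (1 - fps_const (u k) * fps_X ^ k) = parts_gf A u"
proof -
  let ?w = "\<lambda>\<pi>. \<Prod>k\<in>#\<pi>. u k"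
  let ?S = "\<lambda>A. {\<pi>. set_mset \<pi> \<subseteq> A}"
  have bij: "bij_betw (add_mset k) (?S (insert k A)) (add_mset k ` ?S (insert k A))"
    by (auto simp: bij_betw_def inj_on_def)
  have "?S (insert k A) = ?S A \<union> add_mset k ` ?S (insert k A)"
  proof (intro equalityI subsetI)
    fix \<pi> assume \<pi>: "\<pi> \<in> ?S (insert k A)"
    show "\<pi> \<in> ?S A \<union> add_mset k ` ?S (insert k A)"
    proof (cases "k \<in># \<pi>")
      case True
      hence "\<pi> = add_mset k (\<pi> - {#k#})" by simp
      moreover have "\<pi> - {#k#} \<in> ?S (insert k A)" using \<pi> by (auto dest: in_diffD)
      ultimately show ?thesis by blast
    qed (use \<pi> in auto)
  qed auto
  hence "parts_gf (insert k A) u = gf (?S A \<union> add_mset k ` ?S (insert k A)) ?w"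
    by (simp add: parts_gf_def)
  also have "\<dots> = parts_gf A u + gf (add_mset k ` ?S (insert k A)) ?w"
    unfolding parts_gf_def using assms by (intro gf_Un) (auto simp: partitions_def)
  also have "gf (add_mset k ` ?S (insert k A)) ?w = fps_const (u k) * fps_X ^ k * parts_gf (insert k A) u"
    unfolding parts_gf_def by (rule gf_bij[OF bij]) auto
  finally have "parts_gf (insert k A) u - fps_const (u k) * fps_X ^ k * parts_gf (insert k A) u = parts_gf A u"
    unfolding diff_eq_eq .
  thus ?thesis by (simp only: right_diff_distrib mult_1_left mult.commute)
qed

lemma parts_gf_remove:
  assumes "finite B" "0 \<notin> A" "B \<subseteq> A"
  shows "parts_gf A u * (\<Prod>k\<in>B. 1 - fps_const (u k) * fps_X ^ k) = parts_gf (A - B) u"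
  using assms(1,3)
proof (induction B)
  case (insert k B)
  have "insert k (A - insert k B) = A - B" using insert by auto
  moreover have "k \<noteq> 0" using insert.prems assms(2) by (metis insert_subset)
  ultimately have removed: "parts_gf (A - B) u * (1 - fps_const (u k) * fps_X ^ k) = parts_gf (A - insert k B) u"
    using parts_gf_insert[of "A - insert k B" k u] assms(2) by auto
  have "parts_gf A u * (\<Prod>k\<in>insert k B. 1 - fps_const (u k) * fps_X ^ k)
      = (parts_gf A u * (\<Prod>k\<in>B. 1 - fps_const (u k) * fps_X ^ k)) * (1 - fps_const (u k) * fps_X ^ k)"
    by (simp only: prod.insert[OF insert.hyps(1,2)] mult_ac)
  also have "\<dots> = parts_gf (A - insert k B) u"
    using insert removed by simp
  finally show ?case .
qed simp

lemma parts_gf_nth: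
  assumes "\<And>k. k \<in> A \<Longrightarrow> n < k"
  shows "fps_nth (parts_gf A u) n = (if n = 0 then 1 else 0)"
proof -
  have only_empty: "n = 0 \<and> \<pi> = {#}" if "set_mset \<pi> \<subseteq> A" "sum_mset \<pi> = n" for \<pi>
  proof -
    have "\<pi> = {#}"
    proof (rule ccontr)
      assume "\<pi> \<noteq> {#}"
      then obtain k where "k \<in># \<pi>" by auto
      hence "k \<le> n" using that(2) member_le_sum_mset[of k \<pi>] by auto
      moreover have "k \<in> A" using that(1) \<open>k \<in># \<pi>\<close> by auto
      ultimately show False using assms[of k] by simp
    qed
    thus ?thesis using that(2) by simp
  qed
  have "{\<pi> \<in> {\<pi>. set_mset \<pi> \<subseteq> A}. sum_mset \<pi> = n} = {\<pi>. n = 0 \<and> \<pi> = {#}}"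
  proof (intro Collect_cong iffI)
    fix \<pi> assume "\<pi> \<in> {\<pi>. set_mset \<pi> \<subseteq> A} \<and> sum_mset \<pi> = n"
    thus "n = 0 \<and> \<pi> = {#}" by (intro only_empty) simp_all
  qed simp
  hence "fps_nth (parts_gf A u) n = (\<Sum>\<pi> | n = 0 \<and> \<pi> = {#}. \<Prod>k\<in>#\<pi>. u k)"
    unfolding parts_gf_def gf_def fps_nth_Abs_fps by (rule sum.cong) (rule refl)
  thus ?thesis by (cases "n = 0") simp_all
qed

lemma parts_gf_empty: "parts_gf {} u = 1"
proof (rule fps_ext)
  fix n
  have "fps_nth (parts_gf {} u) n = (if n = 0 then 1 else 0)"
    by (rule parts_gf_nth) blast
  thus "fps_nth (parts_gf {} u) n = fps_nth 1 n" by (simp only: fps_one_nth)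
qed

lemma prod_interval: "(\<Prod>i\<in>{k<..k+n}. f i) = (\<Prod>i<n. f (Suc (k + i)))"
proof -
  have "bij_betw (\<lambda>i. Suc (k + i)) {..<n} {k<..k+n}"
    by (rule bij_betwI[of _ _ _ "\<lambda>i. i - Suc k"]) auto
  thus ?thesis by (metis prod.reindex_bij_betw)
qed

lemma parts_gf_greaterThan:
  fixes b :: "'a::idom"
  shows "parts_gf {k<..} (\<lambda>_. b) * qpochhammer_inf (fps_const b * fps_X ^ Suc k) fps_X = 1"
proof (rule fps_ext)
  fix n
  have "fps_nth (parts_gf {k<..} (\<lambda>_. b) * qpochhammer_inf (fps_const b * fps_X ^ Suc k) fps_X) n
      = fps_nth (parts_gf {k<..} (\<lambda>_. b) * (\<Prod>i<n. 1 - (fps_const b * fps_X ^ Suc k) * fps_X ^ i)) n"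
    by (intro fps_mult_nth_cong qpochhammer_inf_nth) auto
  also have "(\<Prod>i<n. 1 - (fps_const b * fps_X ^ Suc k) * fps_X ^ i) = (\<Prod>i\<in>{k<..k+n}. 1 - fps_const b * fps_X ^ i)"
    by (simp add: prod_interval power_add mult_ac)
  also have "parts_gf {k<..} (\<lambda>_. b) * \<dots> = parts_gf ({k<..} - {k<..k+n}) (\<lambda>_. b)"
    by (rule parts_gf_remove) auto
  also have "fps_nth \<dots> n = (if n = 0 then 1 else 0)"
    by (rule parts_gf_nth) auto
  finally show "fps_nth (parts_gf {k<..} (\<lambda>_. b) * qpochhammer_inf (fps_const b * fps_X ^ Suc k) fps_X) n
      = fps_nth 1 n"
    by simp
qed

lemma distinct_partitions_mono: "\<pi> \<in> \<P>\<D> \<Longrightarrow> \<rho> \<subseteq># \<pi> \<Longrightarrow> \<rho> \<in> \<P>\<D>"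
  unfolding distinct_partitions_def partitions_def
  by (auto simp: subseteq_mset_def intro: le_trans dest: mset_subset_eqD[unfolded subseteq_mset_def])

definition distinct_gf :: "nat set \<Rightarrow> 'a::comm_ring_1 fps"
  where "distinct_gf A = gf {\<pi> \<in> \<P>\<D>. set_mset \<pi> \<subseteq> A} (\<lambda>_. 1)"

lemma distinct_gf_insert:
  assumes "k \<noteq> 0" "k \<notin> A"
  shows "distinct_gf (insert k A) = (1 + fps_X ^ k) * distinct_gf A"
proof -
  let ?S = "\<lambda>A. {\<pi> \<in> \<P>\<D>. set_mset \<pi> \<subseteq> A}"
  have bij: "bij_betw (add_mset k) (?S A) (add_mset k ` ?S A)"
    by (auto simp: bij_betw_def inj_on_def)
  have "?S (insert k A) = ?S A \<union> add_mset k ` ?S A"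
  proof (intro equalityI subsetI)
    fix \<pi> assume \<pi>: "\<pi> \<in> ?S (insert k A)"
    show "\<pi> \<in> ?S A \<union> add_mset k ` ?S A"
    proof (cases "k \<in># \<pi>")
      case True
      hence eq: "\<pi> = add_mset k (\<pi> - {#k#})" by simp
      have "count \<pi> k \<le> 1" using \<pi> by (auto simp: distinct_partitions_def)
      hence "k \<notin># \<pi> - {#k#}" by (simp flip: count_eq_zero_iff)
      moreover have "set_mset (\<pi> - {#k#}) \<subseteq> insert k A" "\<pi> - {#k#} \<in> \<P>\<D>"
        using \<pi> by (auto dest: in_diffD intro: distinct_partitions_mono)
      ultimately have "\<pi> - {#k#} \<in> ?S A" by auto
      thus ?thesis using eq by blast
    qed (use \<pi> in auto)
  next
    fix \<pi> assume "\<pi> \<in> ?S A \<union> add_mset k ` ?S A"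
    thus "\<pi> \<in> ?S (insert k A)"
    proof
      assume "\<pi> \<in> add_mset k ` ?S A"
      then obtain \<rho> where \<rho>: "\<pi> = add_mset k \<rho>" "\<rho> \<in> ?S A" by auto
      hence "count \<rho> k = 0" using assms by (auto simp: count_eq_zero_iff)
      thus ?thesis using \<rho> assms by (auto simp: distinct_partitions_def partitions_def)
    qed auto
  qed
  hence "distinct_gf (insert k A) = gf (?S A \<union> add_mset k ` ?S A) (\<lambda>_. 1)"
    by (simp add: distinct_gf_def)
  also have "\<dots> = distinct_gf A + gf (add_mset k ` ?S A) (\<lambda>_. 1)"
    unfolding distinct_gf_def using assms
    by (intro gf_Un) (auto simp: partitions_def distinct_partitions_def)
  also have "gf (add_mset k ` ?S A) (\<lambda>_. 1) = fps_const 1 * fps_X ^ k * (distinct_gf A :: 'a fps)"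
    unfolding distinct_gf_def by (rule gf_bij[OF bij]) auto
  finally show ?thesis by (simp add: algebra_simps)
qed

lemma distinct_gf_interval: "distinct_gf {0<..n} = (\<Prod>k\<in>{0<..n}. 1 + fps_X ^ k)"
proof (induction n)
  case 0
  have "{\<pi>. (\<pi> \<in> \<P>\<D> \<and> \<pi> = {#}) \<and> sum_mset \<pi> = n} = {\<pi>. n = 0 \<and> \<pi> = {#}}" for n
    by (auto simp: distinct_partitions_def partitions_def)
  thus ?case by (simp add: distinct_gf_def gf_def fps_eq_iff)
next
  case (Suc n)
  have "{0<..Suc n} = insert (Suc n) {0<..n}" by auto
  thus ?case using Suc by (simp add: distinct_gf_insert del: power_Suc)
qed

lemma gf_distinct_mult_qpochhammer:
  "gf \<P>\<D> (\<lambda>_. 1) * qpochhammer_inf fps_X fps_X = (qpochhammer_inf (fps_X ^ 2) (fps_X ^ 2) :: 'a::idom fps)"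
proof (rule fps_ext)
  fix n
  have low: "fps_nth (gf \<P>\<D> (\<lambda>_. 1)) j = fps_nth (distinct_gf {0<..n} :: 'a fps) j" if "j \<le> n" for j
  proof -
    have "set_mset \<pi> \<subseteq> {0<..n}" if "\<pi> \<in> \<P>\<D>" "sum_mset \<pi> = j" for \<pi>
    proof
      fix k assume "k \<in># \<pi>"
      moreover have "k \<le> sum_mset \<pi>" using member_le_sum_mset[OF \<open>k \<in># \<pi>\<close>] .
      ultimately show "k \<in> {0<..n}" using that \<open>j \<le> n\<close>
        by (auto simp: distinct_partitions_def partitions_def intro!: gr0I)
    qed
    hence "{\<pi> \<in> \<P>\<D>. sum_mset \<pi> = j} = {\<pi> \<in> {\<pi> \<in> \<P>\<D>. set_mset \<pi> \<subseteq> {0<..n}}. sum_mset \<pi> = j}" by auto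
    thus ?thesis by (simp add: distinct_gf_def gf_def)
  qed
  have "fps_nth (gf \<P>\<D> (\<lambda>_. 1) * qpochhammer_inf fps_X fps_X) n
      = fps_nth (distinct_gf {0<..n} * (\<Prod>k<n. 1 - fps_X * fps_X ^ k) :: 'a fps) n"
    by (intro fps_mult_nth_cong qpochhammer_inf_nth low) auto
  also have "distinct_gf {0<..n} = (\<Prod>k<n. 1 + fps_X * fps_X ^ k :: 'a fps)"
    using prod_interval[of "\<lambda>k. 1 + fps_X ^ k :: 'a fps" 0 n] by (simp add: distinct_gf_interval)
  also have "\<dots> * (\<Prod>k<n. 1 - fps_X * fps_X ^ k) = (\<Prod>k<n. 1 - fps_X ^ 2 * (fps_X ^ 2) ^ k :: 'a fps)"
  proof -
    have "(1 + x * x ^ k) * (1 - x * x ^ k) = 1 - x ^ 2 * (x ^ 2) ^ k" for x :: "'a fps" and k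
      by (simp add: algebra_simps power2_eq_square power_mult_distrib)
    thus ?thesis unfolding prod.distrib[symmetric] by (simp only:)
  qed
  also have "fps_nth \<dots> n = fps_nth (qpochhammer_inf (fps_X ^ 2) (fps_X ^ 2)) n"
    by (rule qpochhammer_inf_nth[symmetric]) auto
  finally show "fps_nth (gf \<P>\<D> (\<lambda>_. 1) * qpochhammer_inf fps_X fps_X) n
      = fps_nth (qpochhammer_inf (fps_X ^ 2) (fps_X ^ 2) :: 'a fps) n" .
qed

section \<open>The crank generating function\<close>

lemma zpow_mult: "zpow a * zpow b = zpow (a + b)"
  by (simp add: zpow_def Poly_Mapping.mult_single)

lemma zpow_0: "zpow 0 = 1"
  by (simp add: zpow_def)

lemma zpow_power: "zpow a ^ n = zpow (int n * a)"
  by (induction n) (simp_all add: zpow_0 zpow_mult algebra_simps)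

text \<open>In the usual notation \<open>qfact_inv k\<close> is \<open>1 / (q; q)\<^sub>k\<close> and \<open>zq_fact k\<close> is \<open>(z q; q)\<^sub>k\<close>.\<close>

abbreviation qfact_inv :: "nat \<Rightarrow> 'a::comm_ring_1 fps"
  where "qfact_inv k \<equiv> parts_gf {0<..k} (\<lambda>_. 1)"

lemma qfact_inv_Suc: "(1 - fps_X ^ Suc k) * qfact_inv (Suc k) = (qfact_inv k :: 'a::comm_ring_1 fps)"
proof -
  have "{0<..Suc k} = insert (Suc k) {0<..k}" by auto
  thus ?thesis
    using parts_gf_insert[of "{0<..k}" "Suc k" "\<lambda>_. 1 :: 'a"] by (simp add: mult.commute del: power_Suc)
qed

lemma qfact_inv_mult: "qfact_inv k * (\<Prod>i\<in>{0<..k}. 1 - fps_X ^ i) = (1 :: 'a::comm_ring_1 fps)"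
  using parts_gf_remove[of "{0<..k}" "{0<..k}" "\<lambda>_. 1 :: 'a"] by (simp add: parts_gf_empty)

lemma qfact_inv_without_ones:
  assumes "k > 0"
  shows "parts_gf {1<..k} (\<lambda>_. 1) = (1 - fps_X) * (qfact_inv k :: 'a::comm_ring_1 fps)"
proof -
  have "insert 1 {1<..k} = {0<..k}" using assms by auto
  thus ?thesis
    using parts_gf_insert[of "{1<..k}" 1 "\<lambda>_. 1 :: 'a"] by (simp add: mult.commute)
qed

lemma euler:
  assumes "fps_nth t 0 = 0"
  shows "fps_suminf (\<lambda>k. qfact_inv k * t ^ k) * qpochhammer_inf t fps_X = (1 :: 'a::idom fps)"
  using q_binomial[of t qfact_inv 0] assms
  by (simp add: qfact_inv_Suc parts_gf_empty qpochhammer_inf_0 del: power_Suc)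

lemma largest_part_mem: "\<pi> \<noteq> {#} \<Longrightarrow> largest_part \<pi> \<in># \<pi>"
  unfolding largest_part_def by (rule Max_in) auto

lemma le_largest_part: "k \<in># \<pi> \<Longrightarrow> k \<le> largest_part \<pi>"
  by (simp add: largest_part_def)

lemma largest_part_eqI: "l \<in># \<pi> \<Longrightarrow> (\<And>k. k \<in># \<pi> \<Longrightarrow> k \<le> l) \<Longrightarrow> largest_part \<pi> = l"
  unfolding largest_part_def by (rule Max_eqI) auto

definition crank_gf :: "nat multiset set \<Rightarrow> laurent_poly fps"
  where "crank_gf S = gf S (\<lambda>\<pi>. zpow (crank \<pi>))"

definition without_ones :: "nat multiset set"
  where "without_ones = {\<pi> \<in> \<P>. \<pi> \<noteq> {#} \<and> 1 \<notin># \<pi>}"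

lemma crank_gf_largest_part:
  assumes "l > 1"
  shows "crank_gf {\<pi> \<in> without_ones. largest_part \<pi> = l}
    = fps_const (zpow (int l)) * fps_X ^ l * parts_gf {1<..l} (\<lambda>_. 1)"
proof -
  let ?S = "{\<pi>. set_mset \<pi> \<subseteq> {1<..l}}"
  have bij: "bij_betw (add_mset l) ?S {\<pi> \<in> without_ones. largest_part \<pi> = l}"
  proof (rule bij_betwI')
    fix \<pi> assume "\<pi> \<in> ?S"
    thus "add_mset l \<pi> \<in> {\<pi> \<in> without_ones. largest_part \<pi> = l}"
      using assms by (auto simp: without_ones_def partitions_def intro!: largest_part_eqI)
  next
    fix \<pi> assume \<pi>: "\<pi> \<in> {\<pi> \<in> without_ones. largest_part \<pi> = l}"
    hence "l \<in># \<pi>" using largest_part_mem[of \<pi>] by (auto simp: without_ones_def)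
    moreover have "set_mset \<pi> \<subseteq> {1<..l}"
    proof
      fix k assume "k \<in># \<pi>"
      moreover have "k \<noteq> 0" "k \<noteq> 1" using \<pi> \<open>k \<in># \<pi>\<close> by (metis (mono_tags, lifting) mem_Collect_eq without_ones_def partitions_def)+
      ultimately show "k \<in> {1<..l}" using \<pi> le_largest_part[of k \<pi>] by auto
    qed
    ultimately show "\<exists>\<rho>\<in>?S. \<pi> = add_mset l \<rho>"
      by (intro bexI[of _ "\<pi> - {#l#}"]) (auto dest: in_diffD)
  qed simp
  show ?thesis
    unfolding crank_gf_def parts_gf_def
  proof (rule gf_bij[OF bij])
    fix \<pi> assume \<pi>: "\<pi> \<in> ?S"
    hence "add_mset l \<pi> \<in> {\<pi> \<in> without_ones. largest_part \<pi> = l}"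
      using bij by (auto simp: bij_betw_def)
    hence "crank (add_mset l \<pi>) = int l"
      by (auto simp: crank_def num_ones_def without_ones_def count_eq_zero_iff)
    thus "zpow (crank (add_mset l \<pi>)) = zpow (int l) * (\<Prod>k\<in>#\<pi>. 1)" by simp
  qed simp
qed

lemma crank_gf_without_ones:
  "1 - fps_X + fps_const (zpow 1) * fps_X + crank_gf without_ones
    = (1 - fps_X) * fps_suminf (\<lambda>k. qfact_inv k * (fps_const (zpow 1) * fps_X) ^ k)"
proof -
  let ?z = "fps_const (zpow 1) * fps_X :: laurent_poly fps"
  let ?f = "\<lambda>k. (1 - fps_X) * (qfact_inv k * ?z ^ k)"
  let ?g = "\<lambda>k. crank_gf {\<pi> \<in> without_ones. largest_part \<pi> = k}"
  have asc: "ascending (\<lambda>k. qfact_inv k * ?z ^ k)"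
    by (rule ascending_mult_power) simp
  have asc_f: "ascending ?f"
    using ascending_mult_power[of ?z "\<lambda>k. (1 - fps_X) * qfact_inv k"] by (simp add: mult.assoc)
  have S: "without_ones \<subseteq> \<P>" "\<And>\<pi>. \<pi> \<in> without_ones \<Longrightarrow> largest_part \<pi> \<le> sum_mset \<pi>"
    using largest_part_mem member_le_sum_mset by (auto simp: without_ones_def)
  have asc_g: "ascending ?g"
    unfolding crank_gf_def by (rule gf_partition_by(2)[OF S])
  have eq: "?f (Suc (Suc k)) = ?g (Suc (Suc k))" for k
  proof -
    have "?g (Suc (Suc k)) = fps_const (zpow (int (Suc (Suc k)))) * fps_X ^ Suc (Suc k)
        * ((1 - fps_X) * qfact_inv (Suc (Suc k)))"
      by (subst crank_gf_largest_part, simp, subst qfact_inv_without_ones, simp, rule refl)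
    thus ?thesis
      by (simp only: power_mult_distrib fps_const_power zpow_power mult_1_left mult_1_right mult_ac)
  qed
  have empty: "{\<pi> \<in> without_ones. largest_part \<pi> = k} = {}" if "k \<le> 1" for k
  proof -
    have large: "1 < largest_part \<pi>" if "\<pi> \<in> without_ones" for \<pi>
    proof -
      have "largest_part \<pi> \<noteq> 0 \<and> largest_part \<pi> \<noteq> 1"
        using that largest_part_mem[of \<pi>]
        by (metis (mono_tags, lifting) mem_Collect_eq without_ones_def partitions_def)
      thus ?thesis by simp
    qed
    show ?thesis using \<open>k \<le> 1\<close> by (auto dest: large)
  qed
  have asc_Suc: "ascending (\<lambda>k. h (Suc k))" if "ascending h" for h :: "nat \<Rightarrow> laurent_poly fps"
    using that by (auto simp: ascending_def)
  have "(1 - fps_X) * fps_suminf (\<lambda>k. qfact_inv k * ?z ^ k) = fps_suminf ?f"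
    by (rule fps_suminf_mult[OF asc, symmetric])
  also have "\<dots> = ?f 0 + ?f (Suc 0) + fps_suminf (\<lambda>k. ?f (Suc (Suc k)))"
    by (subst fps_suminf_Suc[OF asc_f], subst fps_suminf_Suc[OF asc_Suc[OF asc_f]]) (rule add.assoc[symmetric])
  also have "(\<lambda>k. ?f (Suc (Suc k))) = (\<lambda>k. ?g (Suc (Suc k)))"
    by (intro ext eq)
  also have "fps_suminf \<dots> = fps_suminf ?g"
    by (subst fps_suminf_Suc[OF asc_g], subst fps_suminf_Suc[OF asc_Suc[OF asc_g]])
      (simp add: empty crank_gf_def)
  also have "\<dots> = crank_gf without_ones"
    unfolding crank_gf_def by (rule gf_partition_by(1)[OF S, symmetric])
  also have "?f 0 = 1 - fps_X" by (simp add: parts_gf_empty)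
  also have "?f (Suc 0) = ?z"
    using qfact_inv_Suc[where 'a = laurent_poly, of 0] by (simp add: parts_gf_empty flip: mult.assoc)
  finally show ?thesis ..
qed

definition with_ones :: "nat multiset set"
  where "with_ones = {\<pi> \<in> \<P>. 1 \<in># \<pi>}"

lemma crank_gf_num_ones:
  assumes "k > 0"
  shows "crank_gf {\<pi> \<in> with_ones. num_ones \<pi> = k}
    = fps_const (zpow (- int k)) * fps_X ^ k * parts_gf {1<..} (\<lambda>j. if j > k then zpow 1 else 1)"
proof -
  let ?S = "{\<pi>. set_mset \<pi> \<subseteq> {1::nat<..}}"
  let ?\<phi> = "\<lambda>\<pi>. replicate_mset k 1 + \<pi>"
  have ones: "count \<pi> 1 = 0" if "\<pi> \<in> ?S" for \<pi>
    using that by (auto simp: count_eq_zero_iff)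
  have bij: "bij_betw ?\<phi> ?S {\<pi> \<in> with_ones. num_ones \<pi> = k}"
  proof (rule bij_betwI')
    fix \<pi> assume "\<pi> \<in> ?S"
    thus "?\<phi> \<pi> \<in> {\<pi> \<in> with_ones. num_ones \<pi> = k}"
      using assms ones[of \<pi>] by (auto simp: with_ones_def num_ones_def partitions_def)
  next
    fix \<pi> assume \<pi>: "\<pi> \<in> {\<pi> \<in> with_ones. num_ones \<pi> = k}"
    define \<rho> where "\<rho> = {#j \<in># \<pi>. j \<noteq> 1#}"
    have "\<pi> = ?\<phi> \<rho>"
      using \<pi> by (intro multiset_eqI) (auto simp: \<rho>_def num_ones_def)
    moreover have "\<rho> \<in> ?S"
      using \<pi> by (auto simp: \<rho>_def with_ones_def partitions_def nat_neq_iff)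
    ultimately show "\<exists>\<rho>\<in>?S. \<pi> = ?\<phi> \<rho>" by blast
  qed simp
  show ?thesis
    unfolding crank_gf_def parts_gf_def
  proof (rule gf_bij[OF bij])
    fix \<pi> assume \<pi>: "\<pi> \<in> ?S"
    have prod: "(\<Prod>j\<in>#\<pi>. if j > k then zpow 1 else 1) = zpow (int (size {#j \<in># \<pi>. j > k#}))" for \<pi>
      by (induction \<pi>) (auto simp: zpow_0 zpow_mult)
    have "num_ones (?\<phi> \<pi>) = k" using ones[OF \<pi>] by (simp add: num_ones_def)
    moreover have "{#j \<in># replicate_mset k 1. j > k#} = {#}"
      using assms by (auto simp: multiset_eq_iff)
    ultimately have "crank (?\<phi> \<pi>) = - int k + int (size {#j \<in># \<pi>. j > k#})"
      using assms by (simp add: crank_def num_parts_above_ones_def)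
    thus "zpow (crank (?\<phi> \<pi>)) = zpow (- int k) * (\<Prod>j\<in>#\<pi>. if j > k then zpow 1 else 1)"
      by (simp add: prod zpow_mult)
  qed simp
qed

definition zq_fact :: "nat \<Rightarrow> laurent_poly fps"
  where "zq_fact k = (\<Prod>i<k. 1 - fps_const (zpow 1) * fps_X * fps_X ^ i)"

lemma crank_gf_num_ones_mult:
  assumes "k > 0"
  shows "crank_gf {\<pi> \<in> with_ones. num_ones \<pi> = k} * qpochhammer_inf (fps_const (zpow 1) * fps_X) fps_X
    = (1 - fps_X) * (zq_fact k * qfact_inv k * (fps_const (zpow (-1)) * fps_X) ^ k)"
proof -
  let ?u = "\<lambda>j. if j > k then zpow 1 else 1"
  let ?z = "fps_const (zpow 1) * fps_X :: laurent_poly fps"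
  let ?H = "parts_gf {1<..} ?u"
  let ?P = "\<Prod>i\<in>{1<..k}. 1 - fps_X ^ i :: laurent_poly fps"
  have "{1<..} - {1<..k} = {k<..}" using assms by auto
  moreover have "(\<Prod>i\<in>{1<..k}. 1 - fps_const (?u i) * fps_X ^ i) = ?P"
    by (intro prod.cong) auto
  ultimately have "?H * ?P = parts_gf {k<..} ?u"
    using parts_gf_remove[of "{1<..k}" "{1<..}" ?u] by (simp add: greaterThanAtMost_def)
  also have "\<dots> = parts_gf {k<..} (\<lambda>_. zpow 1)"
    by (rule parts_gf_cong) simp
  finally have H: "?H * ?P = parts_gf {k<..} (\<lambda>_. zpow 1)" .
  have Pz: "qpochhammer_inf ?z fps_X = zq_fact k * qpochhammer_inf (fps_const (zpow 1) * fps_X ^ Suc k) fps_X"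
    using qpochhammer_inf_split[of ?z fps_X k] by (simp add: zq_fact_def mult.assoc)
  have "?H * ?P * qpochhammer_inf ?z fps_X
      = zq_fact k * (parts_gf {k<..} (\<lambda>_. zpow 1) * qpochhammer_inf (fps_const (zpow 1) * fps_X ^ Suc k) fps_X)"
    unfolding H Pz by (rule mult.left_commute)
  also have "\<dots> = zq_fact k"
    by (simp only: parts_gf_greaterThan mult_1_right)
  finally have HP: "?H * ?P * qpochhammer_inf ?z fps_X = zq_fact k" .
  have "{0<..k} = insert 1 {1<..k}" using assms by auto
  hence "(\<Prod>i\<in>{0<..k}. 1 - fps_X ^ i :: laurent_poly fps) = (1 - fps_X) * ?P" by simp
  hence Q: "qfact_inv k * ((1 - fps_X) * ?P) = 1"
    using qfact_inv_mult[where 'a = laurent_poly, of k] by simp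
  have "?H * qpochhammer_inf ?z fps_X = ?H * qpochhammer_inf ?z fps_X * (qfact_inv k * ((1 - fps_X) * ?P))"
    by (simp only: Q mult_1_right)
  also have "\<dots> = (1 - fps_X) * qfact_inv k * (?H * ?P * qpochhammer_inf ?z fps_X)"
    by (simp only: mult_ac)
  also have "\<dots> = (1 - fps_X) * qfact_inv k * zq_fact k"
    by (simp only: HP)
  finally have "?H * qpochhammer_inf ?z fps_X = (1 - fps_X) * qfact_inv k * zq_fact k" .
  moreover have "(fps_const (zpow (-1)) * fps_X) ^ k = (fps_const (zpow (- int k)) * fps_X ^ k :: laurent_poly fps)"
    by (simp add: power_mult_distrib fps_const_power zpow_power)
  ultimately show ?thesis
    by (simp only: crank_gf_num_ones[OF assms] mult.assoc) (simp only: mult_ac)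
qed

lemma crank_gf_with_ones:
  "1 - fps_X + crank_gf with_ones * qpochhammer_inf (fps_const (zpow 1) * fps_X) fps_X
    = (1 - fps_X) * fps_suminf (\<lambda>k. zq_fact k * qfact_inv k * (fps_const (zpow (-1)) * fps_X) ^ k)"
proof -
  let ?t = "fps_const (zpow (-1)) * fps_X :: laurent_poly fps"
  let ?P = "qpochhammer_inf (fps_const (zpow 1) * fps_X) fps_X"
  let ?f = "\<lambda>k. (1 - fps_X) * (zq_fact k * qfact_inv k * ?t ^ k)"
  let ?g = "\<lambda>k. crank_gf {\<pi> \<in> with_ones. num_ones \<pi> = k}"
  have asc: "ascending (\<lambda>k. zq_fact k * qfact_inv k * ?t ^ k)"
    by (rule ascending_mult_power) simp
  have asc_f: "ascending ?f"
    using ascending_mult_power[of ?t "\<lambda>k. (1 - fps_X) * (zq_fact k * qfact_inv k)"] by (simp add: mult.assoc)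
  have "num_ones \<pi> \<le> sum_mset \<pi>" if "0 \<notin># \<pi>" for \<pi>
    using that by (induction \<pi>) (auto simp: num_ones_def)
  hence S: "with_ones \<subseteq> \<P>" "\<And>\<pi>. \<pi> \<in> with_ones \<Longrightarrow> num_ones \<pi> \<le> sum_mset \<pi>"
    by (auto simp: with_ones_def partitions_def)
  have asc_g: "ascending ?g"
    unfolding crank_gf_def by (rule gf_partition_by(2)[OF S])
  have g0: "?g 0 = 0"
  proof -
    have "{\<pi> \<in> with_ones. num_ones \<pi> = 0} = {}" by (auto simp: with_ones_def num_ones_def)
    thus ?thesis unfolding crank_gf_def by (simp only: gf_empty)
  qed
  have asc_g': "ascending (\<lambda>k. ?g (Suc k))"
    using asc_g by (auto simp: ascending_def)
  have "(1 - fps_X) * fps_suminf (\<lambda>k. zq_fact k * qfact_inv k * ?t ^ k) = fps_suminf ?f"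
    by (rule fps_suminf_mult[OF asc, symmetric])
  also have "\<dots> = ?f 0 + fps_suminf (\<lambda>k. ?f (Suc k))"
    by (rule fps_suminf_Suc[OF asc_f])
  also have "(\<lambda>k. ?f (Suc k)) = (\<lambda>k. ?P * ?g (Suc k))"
    by (rule ext, subst mult.commute[of ?P], rule crank_gf_num_ones_mult[symmetric]) simp
  also have "fps_suminf \<dots> = ?P * fps_suminf (\<lambda>k. ?g (Suc k))"
    by (rule fps_suminf_mult[OF asc_g'])
  also have "fps_suminf (\<lambda>k. ?g (Suc k)) = fps_suminf ?g"
    by (subst fps_suminf_Suc[OF asc_g]) (simp add: g0)
  also have "\<dots> = crank_gf with_ones"
    unfolding crank_gf_def by (rule gf_partition_by(1)[OF S, symmetric])
  also have "?f 0 = 1 - fps_X" by (simp add: parts_gf_empty zq_fact_def)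
  finally show ?thesis by (simp add: mult.commute)
qed

text \<open>
  The partition \<open>{#1#}\<close> has crank \<open>- 1\<close>, whereas the product side has \<open>z - 1 + 1 / z\<close> as coefficient
  of \<open>q\<close>; together with the empty partition this gives the correction \<open>1 - q + z q\<close>.
\<close>

lemma crank_gf_nonempty:
  "(crank_gf (\<P> - {{#}}) + (1 - fps_X + fps_const (zpow 1) * fps_X)) * Mbar_denominator
    = qpochhammer_inf fps_X fps_X"
proof -
  let ?z = "fps_const (zpow 1) * fps_X :: laurent_poly fps"
  let ?t = "fps_const (zpow (-1)) * fps_X :: laurent_poly fps"
  let ?Pz = "qpochhammer_inf ?z fps_X"
  let ?Pt = "qpochhammer_inf ?t fps_X"
  let ?S1 = "fps_suminf (\<lambda>k. qfact_inv k * ?z ^ k)"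
  let ?S2 = "fps_suminf (\<lambda>k. zq_fact k * qfact_inv k * ?t ^ k)"
  have S1: "?S1 * ?Pz = 1"
    by (rule euler) simp
  have "(1 - fps_X ^ Suc k) * (zq_fact (Suc k) * qfact_inv (Suc k))
      = (1 - ?z * fps_X ^ k) * (zq_fact k * qfact_inv k)" for k
  proof -
    have "(1 - fps_X ^ Suc k) * (zq_fact (Suc k) * qfact_inv (Suc k))
        = zq_fact (Suc k) * ((1 - fps_X ^ Suc k) * qfact_inv (Suc k))"
      by (simp only: mult_ac)
    also have "\<dots> = (1 - ?z * fps_X ^ k) * (zq_fact k * qfact_inv k)"
      by (simp only: qfact_inv_Suc zq_fact_def prod.lessThan_Suc mult_ac)
    finally show ?thesis .
  qed
  hence "?S2 * ?Pt = qpochhammer_inf (?z * ?t) fps_X"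
    by (intro q_binomial) (simp_all add: zq_fact_def parts_gf_empty)
  also have "?z * ?t = fps_X * fps_X"
  proof -
    have "?z * ?t = fps_const (zpow 1 * zpow (-1)) * (fps_X * fps_X)"
      by (simp only: mult_ac flip: fps_const_mult)
    thus ?thesis by (simp add: zpow_mult zpow_0)
  qed
  finally have S2: "?S2 * ?Pt = qpochhammer_inf (fps_X * fps_X) fps_X" .
  have "\<P> - {{#}} = without_ones \<union> with_ones"
    by (auto simp: without_ones_def with_ones_def)
  moreover have "gf (without_ones \<union> with_ones) w = gf without_ones w + gf with_ones w" for w :: "nat multiset \<Rightarrow> laurent_poly"
    by (rule gf_Un) (auto simp: without_ones_def with_ones_def)
  ultimately have "crank_gf (\<P> - {{#}}) = crank_gf without_ones + crank_gf with_ones"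
    by (simp add: crank_gf_def)
  hence "crank_gf (\<P> - {{#}}) + (1 - fps_X + ?z) = (1 - fps_X + ?z + crank_gf without_ones) + crank_gf with_ones"
    by (simp only: add_ac)
  also have "\<dots> = (1 - fps_X) * ?S1 + crank_gf with_ones"
    by (simp only: crank_gf_without_ones)
  finally have total: "crank_gf (\<P> - {{#}}) + (1 - fps_X + ?z) = (1 - fps_X) * ?S1 + crank_gf with_ones" .
  have "(crank_gf (\<P> - {{#}}) + (1 - fps_X + ?z)) * (?Pz * ?Pt)
      = ((1 - fps_X) * (?S1 * ?Pz) + crank_gf with_ones * ?Pz) * ?Pt"
    unfolding total by (simp only: distrib_right mult.assoc)
  also have "\<dots> = (1 - fps_X) * (?S2 * ?Pt)"
    by (simp only: S1 mult_1_right crank_gf_with_ones mult.assoc)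
  also have "\<dots> = qpochhammer_inf fps_X fps_X"
    using qpochhammer_inf_split[where a = fps_X and q = "fps_X :: laurent_poly fps" and n = 1] S2 by simp
  finally show ?thesis .
qed

section \<open>Distinct partitions and overpartitions\<close>

text \<open>
  Increasing the largest part by one turns a distinct partition of \<open>n\<close> into one of \<open>n + 1\<close> that
  lacks the part one below the largest; the empty partition goes to \<open>{#1#}\<close>.
\<close>

definition bump :: "nat multiset \<Rightarrow> nat multiset"
  where "bump \<pi> = (if \<pi> = {#} then {#1#} else add_mset (Suc (largest_part \<pi>)) (\<pi> - {#largest_part \<pi>#}))"

definition unbump :: "nat multiset \<Rightarrow> nat multiset"
  where "unbump \<pi> = (if \<pi> = {#1#} then {#} else add_mset (largest_part \<pi> - 1) (\<pi> - {#largest_part \<pi>#}))"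

lemma distinct_partition_split:
  assumes "\<pi> \<in> \<P>\<D>" "\<pi> \<noteq> {#}"
  obtains l \<rho> where "\<pi> = add_mset l \<rho>" "largest_part \<pi> = l" "l \<noteq> 0" "\<rho> \<in> \<P>\<D>" "\<And>k. k \<in># \<rho> \<Longrightarrow> k < l"
proof
  let ?l = "largest_part \<pi>" and ?\<rho> = "\<pi> - {#largest_part \<pi>#}"
  have l: "?l \<in># \<pi>" using assms largest_part_mem by blast
  thus "\<pi> = add_mset ?l ?\<rho>" by simp
  show "?l \<noteq> 0" using l assms(1) unfolding distinct_partitions_def partitions_def by (metis (no_types, lifting) mem_Collect_eq)
  show "?\<rho> \<in> \<P>\<D>" using assms(1) by (rule distinct_partitions_mono) simp
  fix k assume k: "k \<in># ?\<rho>"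
  have "count \<pi> ?l \<le> 1" using assms(1) by (simp add: distinct_partitions_def)
  hence "?l \<notin># ?\<rho>" by (simp flip: count_eq_zero_iff)
  hence "k \<noteq> ?l" using k by auto
  thus "k < ?l" using le_largest_part[of k \<pi>] in_diffD[OF k] by simp
qed simp

lemma add_largest_distinct:
  assumes "\<rho> \<in> \<P>\<D>" "l \<noteq> 0" "\<And>k. k \<in># \<rho> \<Longrightarrow> k < l"
  shows "add_mset l \<rho> \<in> \<P>\<D>" "largest_part (add_mset l \<rho>) = l"
proof -
  have "count \<rho> l = 0" using assms(3)[of l] by (auto simp: count_eq_zero_iff)
  thus "add_mset l \<rho> \<in> \<P>\<D>" using assms(1,2) by (auto simp: distinct_partitions_def partitions_def)
  show "largest_part (add_mset l \<rho>) = l"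
    by (rule largest_part_eqI) (use assms(3) in \<open>auto intro: less_imp_le\<close>)
qed

lemma bump_properties:
  assumes "\<pi> \<in> \<P>\<D>"
  shows "bump \<pi> \<in> \<P>\<D> \<and> lambda_stat (bump \<pi>) = 1 \<and> sum_mset (bump \<pi>) = 1 + sum_mset \<pi> \<and> unbump (bump \<pi>) = \<pi>"
proof (cases "\<pi> = {#}")
  case True
  thus ?thesis
    by (auto simp: bump_def unbump_def distinct_partitions_def partitions_def lambda_stat_def largest_part_def)
next
  case False
  from assms False obtain l \<rho> where *: "\<pi> = add_mset l \<rho>" "largest_part \<pi> = l" "l \<noteq> 0" "\<rho> \<in> \<P>\<D>"
    and less: "\<And>k. k \<in># \<rho> \<Longrightarrow> k < l"
    by (rule distinct_partition_split) blast
  have bump: "bump \<pi> = add_mset (Suc l) \<rho>" using *(1,2) by (simp add: bump_def)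
  have "add_mset (Suc l) \<rho> \<in> \<P>\<D>" "largest_part (add_mset (Suc l) \<rho>) = Suc l"
    using *(4) less by (auto intro!: add_largest_distinct intro: less_SucI)
  moreover have "l \<notin># \<rho>" using less by blast
  ultimately show ?thesis
    unfolding bump using * by (auto simp: lambda_stat_def unbump_def)
qed

lemma unbump_properties:
  assumes "\<pi> \<in> \<P>\<D>" "lambda_stat \<pi> = 1"
  shows "unbump \<pi> \<in> \<P>\<D> \<and> bump (unbump \<pi>) = \<pi>"
proof (cases "\<pi> = {#1#}")
  case True
  thus ?thesis
    by (auto simp: bump_def unbump_def distinct_partitions_def partitions_def)
next
  case False
  have "\<pi> \<noteq> {#}" using assms(2) by (auto simp: lambda_stat_def)
  with assms(1) obtain l \<rho> where *: "\<pi> = add_mset l \<rho>" "largest_part \<pi> = l" "l \<noteq> 0" "\<rho> \<in> \<P>\<D>"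
    and less: "\<And>k. k \<in># \<rho> \<Longrightarrow> k < l"
    by (rule distinct_partition_split) blast
  have unbump: "unbump \<pi> = add_mset (l - 1) \<rho>" using *(1,2) False by (simp add: unbump_def)
  have gap: "l - 1 \<notin># \<rho>"
    using assms(2) * by (auto simp: lambda_stat_def split: if_splits)
  have "l \<noteq> 1"
  proof
    assume "l = 1"
    hence "\<rho> = {#}" using less *(4)
      by (metis (mono_tags, lifting) less_one distinct_partitions_def mem_Collect_eq multiset_nonemptyE partitions_def)
    thus False using False *(1) \<open>l = 1\<close> by simp
  qed
  moreover have "k < l - 1" if "k \<in># \<rho>" for k
    using less[OF that] gap that by (cases "k = l - 1") auto
  ultimately have "add_mset (l - 1) \<rho> \<in> \<P>\<D>" "largest_part (add_mset (l - 1) \<rho>) = l - 1"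
    using *(3,4) by (auto intro!: add_largest_distinct)
  thus ?thesis unfolding unbump using * by (simp add: bump_def)
qed

lemma gf_lambda_stat:
  "gf \<P>\<D> (\<lambda>\<pi>. zpow (lambda_stat \<pi>)) = gf \<P>\<D> (\<lambda>_. 1) * (1 - fps_X + fps_const (zpow 1) * fps_X)"
proof -
  let ?A = "{\<pi> \<in> \<P>\<D>. lambda_stat \<pi> = 1}" and ?B = "{\<pi> \<in> \<P>\<D>. lambda_stat \<pi> \<noteq> 1}"
  have bij: "bij_betw bump \<P>\<D> ?A"
    using bump_properties unbump_properties by (intro bij_betwI[of _ _ _ unbump]) auto
  have A: "gf ?A w = fps_const c * fps_X * gf \<P>\<D> (\<lambda>_. 1)"
    if "\<And>\<pi>. lambda_stat \<pi> = 1 \<Longrightarrow> w \<pi> = c" for w and c :: laurent_poly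
    using gf_bij[OF bij, of 1 w c "\<lambda>_. 1"] bump_properties that by simp
  have split: "gf \<P>\<D> w = gf ?A w + gf ?B w" for w :: "nat multiset \<Rightarrow> laurent_poly"
  proof -
    have "\<P>\<D> = ?A \<union> ?B" by blast
    thus ?thesis by (subst (1) \<open>\<P>\<D> = ?A \<union> ?B\<close>, intro gf_Un) (auto simp: distinct_partitions_def)
  qed
  have B: "gf ?B (\<lambda>\<pi>. zpow (lambda_stat \<pi>)) = gf ?B (\<lambda>_. 1)"
    by (rule gf_cong) (auto simp: lambda_stat_def zpow_0 split: if_splits)
  have "gf ?B (\<lambda>_. 1) = gf \<P>\<D> (\<lambda>_. 1) - fps_X * (gf \<P>\<D> (\<lambda>_. 1) :: laurent_poly fps)"
    using split[of "\<lambda>_. 1"] A[of "\<lambda>_. 1" 1] by (simp add: eq_diff_eq add.commute)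
  moreover have "gf ?A (\<lambda>\<pi>. zpow (lambda_stat \<pi>)) = fps_const (zpow 1) * fps_X * gf \<P>\<D> (\<lambda>_. 1)"
    by (rule A) simp
  ultimately show ?thesis
    using split[of "\<lambda>\<pi>. zpow (lambda_stat \<pi>)"] B by (simp add: algebra_simps)
qed

lemma gf_mult_nth:
  assumes "S \<subseteq> \<P>" "T \<subseteq> \<P>"
  shows "fps_nth (gf S v * gf T w) n
    = (\<Sum>\<pi> | fst \<pi> \<in> S \<and> snd \<pi> \<in> T \<and> sum_mset (fst \<pi>) + sum_mset (snd \<pi>) = n. v (fst \<pi>) * w (snd \<pi>))"
proof -
  let ?F = "\<lambda>i. {\<pi> \<in> S. sum_mset \<pi> = i} \<times> {\<pi> \<in> T. sum_mset \<pi> = n - i}"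
  have fin: "finite {\<pi> \<in> S. sum_mset \<pi> = i}" "finite {\<pi> \<in> T. sum_mset \<pi> = i}" for i
    using assms by (auto intro: finite_partitions_of)
  have "fps_nth (gf S v * gf T w) n = (\<Sum>i=0..n. \<Sum>\<pi>\<in>?F i. v (fst \<pi>) * w (snd \<pi>))"
    unfolding fps_mult_nth gf_def fps_nth_Abs_fps sum_product sum.cartesian_product
    by (simp add: case_prod_beta)
  also have "\<dots> = (\<Sum>\<pi>\<in>(\<Union>i\<in>{0..n}. ?F i). v (fst \<pi>) * w (snd \<pi>))"
    using fin by (intro sum.UNION_disjoint[symmetric]) auto
  also have "(\<Union>i\<in>{0..n}. ?F i) = {\<pi>. fst \<pi> \<in> S \<and> snd \<pi> \<in> T \<and> sum_mset (fst \<pi>) + sum_mset (snd \<pi>) = n}"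
    by force
  finally show ?thesis .
qed

lemma crank1_gf:
  "Abs_fps (\<lambda>n. \<Sum>\<pi>\<in>overpartitions n. zpow (crank1 \<pi>)) = Mbar_gf"
proof -
  let ?G = "Abs_fps (\<lambda>n. \<Sum>\<pi>\<in>overpartitions n. zpow (crank1 \<pi>))"
  let ?D = "gf \<P>\<D> (\<lambda>_. 1) :: laurent_poly fps"
  let ?E = "crank_gf (\<P> - {{#}}) + (1 - fps_X + fps_const (zpow 1) * fps_X)"
  have "?G = ?D * crank_gf (\<P> - {{#}}) + gf \<P>\<D> (\<lambda>\<pi>. zpow (lambda_stat \<pi>))"
  proof (rule fps_ext)
    fix n
    let ?A = "{\<pi>. fst \<pi> \<in> \<P>\<D> \<and> snd \<pi> \<in> \<P> - {{#}} \<and> sum_mset (fst \<pi>) + sum_mset (snd \<pi>) = n}"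
    let ?B = "(\<lambda>\<pi>. (\<pi>, {#})) ` {\<pi> \<in> \<P>\<D>. sum_mset \<pi> = n}"
    have split: "overpartitions n = ?A \<union> ?B"
      by (auto simp: overpartitions_def partitions_def)
    have "(\<Sum>\<pi>\<in>overpartitions n. zpow (crank1 \<pi>)) = (\<Sum>\<pi>\<in>?A. zpow (crank1 \<pi>)) + (\<Sum>\<pi>\<in>?B. zpow (crank1 \<pi>))"
      unfolding split
      by (rule sum.union_disjoint) (use finite_overpartitions[of n] in \<open>auto simp: split\<close>)
    also have "(\<Sum>\<pi>\<in>?A. zpow (crank1 \<pi>)) = fps_nth (?D * crank_gf (\<P> - {{#}})) n"
      unfolding crank_gf_def
      by (subst gf_mult_nth) (auto simp: distinct_partitions_def intro!: sum.cong)
    also have "(\<Sum>\<pi>\<in>?B. zpow (crank1 \<pi>)) = fps_nth (gf \<P>\<D> (\<lambda>\<pi>. zpow (lambda_stat \<pi>))) n"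
      by (subst sum.reindex) (auto simp: gf_def inj_on_def)
    finally show "fps_nth ?G n = fps_nth (?D * crank_gf (\<P> - {{#}}) + gf \<P>\<D> (\<lambda>\<pi>. zpow (lambda_stat \<pi>))) n"
      by simp
  qed
  also have "\<dots> = ?D * ?E"
    by (simp only: gf_lambda_stat distrib_left)
  finally have "?G * Mbar_denominator = ?D * (?E * Mbar_denominator)"
    by (simp only: mult.assoc)
  hence "?G * Mbar_denominator = Mbar_numerator"
    by (simp only: crank_gf_nonempty gf_distinct_mult_qpochhammer)
  thus ?thesis by (simp only: Mbar_gf_unique)
qed

theorem theorem1p2:
  fixes n :: nat and m :: int
  shows "int (card {\<pi> \<in> overpartitions n. crank1 \<pi> = m}) = Mbar m n"
proof -
  have lookup_sum: "Poly_Mapping.lookup (sum f A) m = (\<Sum>x\<in>A. Poly_Mapping.lookup (f x) m)"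
    for f :: "nat multiset \<times> nat multiset \<Rightarrow> laurent_poly" and A
    by (induction A rule: infinite_finite_induct) (simp_all add: lookup_add)
  have "Mbar m n = (\<Sum>\<pi>\<in>overpartitions n. Poly_Mapping.lookup (zpow (crank1 \<pi>)) m)"
    by (simp add: Mbar_def lookup_sum flip: crank1_gf)
  also have "\<dots> = (\<Sum>\<pi>\<in>overpartitions n. if crank1 \<pi> = m then 1 else 0)"
    by (intro sum.cong) (auto simp: zpow_def lookup_single when_def)
  also have "\<dots> = int (card {\<pi> \<in> overpartitions n. crank1 \<pi> = m})"
    by (simp add: finite_overpartitions flip: sum.inter_filter)
  finally show ?thesis ..
qed

end
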